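(* Every collection $\{B_1,B_2\}$ of two finite sets is $p$-splittable for every $0\le p\le 1$.
   Context: A collection $\{B_1,\dots,B_n\}$ of finite sets is $p$-splittable if there is a set $S$ such that for every $i$, $|S\cap B_i|$ is a nearest integer to $p|B_i|$; when $p|B_i|$ is a half-integer, $|S\cap B_i|$ may be either its floor or its ceiling. *)

theory Defs
  imports Complex_Main
begin

(* When x is a half-integer, both the floor and the ceiling of x satisfy this. *)
definition nearest_int :: "int \<Rightarrow> real \<Rightarrow> bool" where
  "nearest_int m x \<longleftrightarrow> (\<forall>k::int. \<bar>real_of_int m - x\<bar> \<le> \<bar>real_of_int k - x\<bar>)"

(* Intended for collections of finite sets only (the card of an infinite set is 0). *)
definition splittable :: "real \<Rightarrow> 'a set set \<Rightarrow> bool" where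
  "splittable p \<B> \<longleftrightarrow>
     (\<exists>S. \<forall>B\<in>\<B>. nearest_int (int (card (S \<inter> B))) (p * real (card B)))"

end

theory Submission
  imports Defs
begin

text \<open>
  Round \<open>p * card B\<^sub>1\<close> and \<open>p * card B\<^sub>2\<close> by the same monotone rule \<open>round\<close>, which commutes with
  integer shifts. Adjoining \<open>k\<close> elements to a set raises its target by at most \<open>k\<close>, so comparing
  both targets with that of \<open>B\<^sub>1 \<inter> B\<^sub>2\<close> shows that neither exceeds the other by more than the
  size of the corresponding set difference, and this suffices for a common \<open>S\<close> to exist.
\<close>

lemma nearest_int_round: "nearest_int (round x) x"
  unfolding nearest_int_def
  using round_diff_minimal[of x] by (simp add: abs_minus_commute)

lemma round_mult_add_le:
  fixes p :: real
  assumes "p \<le> 1"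
  shows "round (p * real (k + n)) \<le> int k + round (p * real n)"
proof -
  have "p * real (k + n) \<le> p * real n + of_int (int k)"
    using mult_right_mono[OF assms, of "real k"] by (simp add: algebra_simps)
  then have "round (p * real (k + n)) \<le> round (p * real n + of_int (int k))"
    by (rule round_mono)
  \<comment> \<open>\<open>round x\<close> is the floor of \<open>x + 1/2\<close>, so half-integers
    always go up, whatever their parity, and integer shifts pass through.\<close>
  also have "\<dots> = int k + round (p * real n)"
    unfolding round_def by linarith
  finally show ?thesis .
qed

text \<open>Meant for k, n, l the sizes of \<open>A - B\<close>, \<open>A \<inter> B\<close> and
  \<open>B\<close>.\<close>

lemma round_mult_le_round_mult_add:
  fixes p :: real
  assumes "0 \<le> p" and "p \<le> 1" and "n \<le> l"
  shows "round (p * real (k + n)) \<le> int k + round (p * real l)"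
proof -
  have "round (p * real n) \<le> round (p * real l)"
    using assms by (intro round_mono mult_left_mono) auto
  then show ?thesis
    using round_mult_add_le[OF assms(2), of k n] by simp
qed

text \<open>If S takes z elements of \<open>A \<inter> B\<close>, it needs \<open>m - z\<close> from
  \<open>A - B\<close> and \<open>n - z\<close> from \<open>B - A\<close>. The four inequalities say
  exactly that the resulting lower bounds on z do not exceed its upper bounds m, n and
  \<open>card (A \<inter> B)\<close>.\<close>

lemma ex_set_with_card_inter:
  assumes "finite A" and "finite B"
    and "m \<le> card A" and "n \<le> card B"
    and "m \<le> card (A - B) + n" and "n \<le> card (B - A) + m"
  shows "\<exists>S. card (S \<inter> A) = m \<and> card (S \<inter> B) = n"
proof -
  have cA: "card A = card (A - B) + card (A \<inter> B)"
    using card_Int_Diff[OF assms(1), of B] by simp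
  have cB: "card B = card (B - A) + card (A \<inter> B)"
    using card_Int_Diff[OF assms(2), of A] by (simp add: Int_commute)
  \<comment> \<open>The least admissible z; truncated subtraction supplies the lower bound
    0.\<close>
  define z where "z = max (m - card (A - B)) (n - card (B - A))"
  have "z \<le> card (A \<inter> B)" "z \<le> m" "z \<le> n"
    and "m - z \<le> card (A - B)" "n - z \<le> card (B - A)"
    using assms(3-6) cA cB unfolding z_def by auto
  then obtain X Y Z where
    X: "X \<subseteq> A - B" "card X = m - z" and
    Y: "Y \<subseteq> B - A" "card Y = n - z" and
    Z: "Z \<subseteq> A \<inter> B" "card Z = z"
    by (meson obtain_subset_with_card_n)
  have fin: "finite X" "finite Y" "finite Z"
    using X Y Z assms(1,2) by (auto intro: finite_subset)
  have "(X \<union> Y \<union> Z) \<inter> A = X \<union> Z" "(X \<union> Y \<union> Z) \<inter> B = Y \<union> Z"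
    "X \<inter> Z = {}" "Y \<inter> Z = {}"
    using X(1) Y(1) Z(1) by auto
  then have "card ((X \<union> Y \<union> Z) \<inter> A) = m" "card ((X \<union> Y \<union> Z) \<inter> B) = n"
    using fin X(2) Y(2) Z(2) \<open>z \<le> m\<close> \<open>z \<le> n\<close> by (simp_all add: card_Un_disjoint)
  then show ?thesis by blast
qed

theorem theorem3p4:
  fixes B\<^sub>1 B\<^sub>2 :: "'a set" and p :: real
  assumes "finite B\<^sub>1" and "finite B\<^sub>2"
    and "0 \<le> p" and "p \<le> 1"
  shows "splittable p {B\<^sub>1, B\<^sub>2}"
proof -
  define r where "r n = round (p * real n)" for n :: nat
  have r_nonneg: "0 \<le> r n" for n
    using round_mono[of 0 "p * real n"] assms(3) by (simp add: r_def)
  have r_le: "r n \<le> int n" for n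
    using round_mult_add_le[OF assms(4), of n 0] by (simp add: r_def)
  have diff: "r (card A) \<le> int (card (A - B)) + r (card B)"
    if "finite A" "finite B" for A B :: "'a set"
  proof -
    have "card A = card (A - B) + card (A \<inter> B)"
      using card_Int_Diff[OF that(1), of B] by simp
    moreover have "card (A \<inter> B) \<le> card B"
      using that(2) by (simp add: card_mono)
    ultimately show ?thesis
      unfolding r_def using round_mult_le_round_mult_add[OF assms(3,4)] by metis
  qed
  \<comment> \<open>Nonnegativity makes \<open>nat\<close> lossless; \<open>diff\<close> in both
    orders gives the two cross conditions.\<close>
  have "\<exists>S. card (S \<inter> B\<^sub>1) = nat (r (card B\<^sub>1)) \<and> card (S \<inter> B\<^sub>2) = nat (r (card B\<^sub>2))"
    using assms(1,2) r_nonneg[of "card B\<^sub>1"] r_nonneg[of "card B\<^sub>2"]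
      r_le[of "card B\<^sub>1"] r_le[of "card B\<^sub>2"] diff[OF assms(1,2)] diff[OF assms(2,1)]
    by (intro ex_set_with_card_inter) linarith+
  then obtain S where "card (S \<inter> B\<^sub>1) = nat (r (card B\<^sub>1))"
    "card (S \<inter> B\<^sub>2) = nat (r (card B\<^sub>2))"
    by blast
  then have "int (card (S \<inter> B)) = r (card B)" if "B \<in> {B\<^sub>1, B\<^sub>2}" for B
    using that r_nonneg by auto
  then show ?thesis
    unfolding splittable_def using nearest_int_round by (metis r_def)
qed

end
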